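(* Let $c\ge 2$, let $d\in\{2,3,4,\dots\}\cup\{\infty\}$, and let $G$ be a $d$-gadget (with respect to $c$). For $D\ge 1$ let $H_D$ denote the graph of depth $D$ constructed from $G$. If $d$ is finite, then there is an integer $D_0$ such that for every $D\ge D_0$ no set of $d$ spanning trees of $H_D$ collectively $+c$-spans $H_D$. If $d=\infty$, then for every positive integer $m$ there is an integer $D_0$ such that for every $D\ge D_0$ no set of $m$ spanning trees of $H_D$ collectively $+c$-spans $H_D$.
   Context: All graphs are connected, finite, undirected, loopless and without multiple edges; $\mathrm{dist}_G(u,v)$ is the number of edges of a shortest path between $u$ and $v$ in $G$. For $c\ge 0$, a set $\mathcal{T}$ of spanning trees of a graph $G$ collectively $+c$-spans $G$ if for any two vertices $u,v$ of $G$ there is a tree $T\in\mathcal{T}$ with $\mathrm{dist}_T(u,v)\le \mathrm{dist}_G(u,v)+c$. A gadget is a graph $G$ with a designated root vertex $r$ and designated terminal vertices $t_1,\dots,t_j$, $j\ge 2$ (root and terminals are distinct vertices). The graph $H_D$ of depth $D$ constructed from $G$ is the complete $j$-ary tree of gadgets with $D$ levels: $H_1=G$ (the root gadget), and for $D>1$, $H_D$ is obtained from a copy of $G$ (the root gadget) by identifying each terminal of this copy with the root of (the root gadget of) its own separate copy of $H_{D-1}$. A spanning tree $T$ of a gadget $G$ is a Fast Connecting (FC) tree of $G$ if $\mathrm{dist}_T(r,t_i)=\mathrm{dist}_G(r,t_i)$ for all $1\le i\le j$. For given $c$ and a positive integer $d$, a gadget $G$ is a $d$-gadget if no $d$ FC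 trees of $G$ collectively $+c$-span $G$, where moreover this is required to be witnessed by terminals: for every collection $\mathcal{T}$ of $d$ FC trees of $G$ there is a pair of terminals $t,t'$ of $G$ such that $\mathrm{dist}_T(t,t')>\mathrm{dist}_G(t,t')+c$ for all $T\in\mathcal{T}$. The gadget $G$ is an $\infty$-gadget if this holds for every set $\mathcal{T}$ of FC trees of $G$, of any size. *)

theory Defs
  imports Complex_Main "HOL-Library.Extended_Nat"
begin

section \<open>Finite simple graphs, distances and spanning trees\<close>

record 'a ugraph =
  verts :: "'a set"
  edges :: "'a set set"

definition simple_graph :: "'a ugraph \<Rightarrow> bool" where
  "simple_graph G \<longleftrightarrow>
     finite (verts G) \<and> edges G \<subseteq> {{u, v} | u v. u \<in> verts G \<and> v \<in> verts G \<and> u \<noteq> v}"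

definition path :: "'a ugraph \<Rightarrow> 'a list \<Rightarrow> bool" where
  "path G p \<longleftrightarrow> p \<noteq> [] \<and> distinct p \<and> set p \<subseteq> verts G \<and>
     successively (\<lambda>u v. {u, v} \<in> edges G) p"

definition path_betw :: "'a ugraph \<Rightarrow> 'a \<Rightarrow> 'a list \<Rightarrow> 'a \<Rightarrow> bool" where
  "path_betw G u p v \<longleftrightarrow> path G p \<and> hd p = u \<and> last p = v"

definition connected_graph :: "'a ugraph \<Rightarrow> bool" where
  "connected_graph G \<longleftrightarrow>
     verts G \<noteq> {} \<and> (\<forall>u\<in>verts G. \<forall>v\<in>verts G. \<exists>p. path_betw G u p v)"

text \<open>Paths are vertex lists, so a path with \<open>Suc n\<close> entries has \<open>n\<close> edges. The value is
  meaningful only for vertices joined by some path.\<close>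

definition gdist :: "'a ugraph \<Rightarrow> 'a \<Rightarrow> 'a \<Rightarrow> nat" where
  "gdist G u v = (LEAST n. \<exists>p. path_betw G u p v \<and> length p = Suc n)"

definition cycle :: "'a ugraph \<Rightarrow> 'a list \<Rightarrow> bool" where
  "cycle G p \<longleftrightarrow> length p \<ge> 3 \<and> path G p \<and> {last p, hd p} \<in> edges G"

definition tree :: "'a ugraph \<Rightarrow> bool" where
  "tree T \<longleftrightarrow> simple_graph T \<and> connected_graph T \<and> (\<nexists>p. cycle T p)"

definition spanning_tree :: "'a ugraph \<Rightarrow> 'a ugraph \<Rightarrow> bool" where
  "spanning_tree T G \<longleftrightarrow> tree T \<and> verts T = verts G \<and> edges T \<subseteq> edges G"

definition collectively_spans :: "real \<Rightarrow> 'a ugraph set \<Rightarrow> 'a ugraph \<Rightarrow> bool" where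
  "collectively_spans c \<T> G \<longleftrightarrow>
     (\<forall>T\<in>\<T>. spanning_tree T G) \<and>
     (\<forall>u\<in>verts G. \<forall>v\<in>verts G. \<exists>T\<in>\<T>. real (gdist T u v) \<le> real (gdist G u v) + c)"

text \<open>A collection of \<open>d\<close> trees may contain repetitions (a graph can have fewer than \<open>d\<close>
  spanning trees), so its underlying set has at most \<open>d\<close> elements. For \<open>d = \<infinity>\<close> there is no
  restriction.\<close>

definition at_most :: "enat \<Rightarrow> 'b set \<Rightarrow> bool" where
  "at_most d X \<longleftrightarrow> (\<forall>k. d = enat k \<longrightarrow> finite X \<and> card X \<le> k)"


section \<open>Gadgets\<close>

text \<open>\<open>gadget G r S\<close>: the graph \<open>G\<close> has root \<open>r\<close> and set of terminals \<open>S\<close>.\<close>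

definition gadget :: "'a ugraph \<Rightarrow> 'a \<Rightarrow> 'a set \<Rightarrow> bool" where
  "gadget G r S \<longleftrightarrow> simple_graph G \<and> connected_graph G \<and>
     r \<in> verts G \<and> S \<subseteq> verts G - {r} \<and> card S \<ge> 2"

definition FC_tree :: "'a ugraph \<Rightarrow> 'a \<Rightarrow> 'a set \<Rightarrow> 'a ugraph \<Rightarrow> bool" where
  "FC_tree G r S T \<longleftrightarrow> spanning_tree T G \<and> (\<forall>t\<in>S. gdist T r t = gdist G r t)"

definition d_gadget :: "real \<Rightarrow> enat \<Rightarrow> 'a ugraph \<Rightarrow> 'a \<Rightarrow> 'a set \<Rightarrow> bool" where
  "d_gadget c d G r S \<longleftrightarrow> gadget G r S \<and>
     (\<forall>\<T>. at_most d \<T> \<and> (\<forall>T\<in>\<T>. FC_tree G r S T) \<longrightarrow>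
        (\<exists>t\<in>S. \<exists>t'\<in>S. \<forall>T\<in>\<T>. real (gdist T t t') > real (gdist G t t') + c))"


section \<open>The tree of gadgets\<close>

text \<open>A vertex \<open>(p, v)\<close> is the vertex \<open>v\<close> of the gadget copy reached from the root gadget
  by following the terminals in \<open>p\<close>. The root of a non-root copy is identified with a
  terminal of its parent copy and carries the name it has there: \<open>attach r t\<close> embeds a
  graph of smaller depth below terminal \<open>t\<close>, sending its root to \<open>([], t)\<close>.\<close>

definition attach :: "'a \<Rightarrow> 'a \<Rightarrow> 'a list \<times> 'a \<Rightarrow> 'a list \<times> 'a" where
  "attach r t = (\<lambda>(p, v). if p = [] \<and> v = r then ([], t) else (t # p, v))"

definition map_graph :: "('a \<Rightarrow> 'b) \<Rightarrow> 'a ugraph \<Rightarrow> 'b ugraph" where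
  "map_graph f G = \<lparr>verts = f ` verts G, edges = (\<lambda>e. f ` e) ` edges G\<rparr>"

text \<open>Depth \<open>0\<close> is a convention (a lone root); with it depth \<open>1\<close> is a copy of \<open>G\<close>, see
  \<open>gadget_graph_1\<close> below.\<close>

primrec gadget_graph :: "'a ugraph \<Rightarrow> 'a \<Rightarrow> 'a set \<Rightarrow> nat \<Rightarrow> ('a list \<times> 'a) ugraph" where
  "gadget_graph G r S 0 = \<lparr>verts = {([], r)}, edges = {}\<rparr>"
| "gadget_graph G r S (Suc D) =
     \<lparr>verts = verts (map_graph (Pair []) G) \<union>
        (\<Union>t\<in>S. verts (map_graph (attach r t) (gadget_graph G r S D))),
      edges = edges (map_graph (Pair []) G) \<union>
        (\<Union>t\<in>S. edges (map_graph (attach r t) (gadget_graph G r S D)))\<rparr>"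

lemma gadget_graph_1:
  assumes "gadget G r S"
  shows "gadget_graph G r S 1 = map_graph (Pair []) G"
  using assms by (auto simp: gadget_def map_graph_def attach_def)

lemma inj_attach:
  assumes "r \<noteq> t"
  shows "inj (attach r t)"
  using assms by (auto simp: inj_on_def attach_def split: if_splits)

lemma attach_meets_root_copy:
  "attach r t x \<in> range (Pair []) \<longleftrightarrow> x = ([], r)"
  by (auto simp: attach_def split: prod.splits)

lemma attach_disjoint:
  assumes "t \<noteq> t'"
  shows "attach r t x \<noteq> attach r t' y"
  using assms by (auto simp: attach_def split: prod.splits if_splits)

lemma root_in_gadget_graph:
  assumes "gadget G r S"
  shows "([], r) \<in> verts (gadget_graph G r S D)"
  using assms by (cases D) (auto simp: gadget_def map_graph_def)

end

theory Submission
  imports Defs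
begin

text \<open>Every copy of the gadget in \<open>H\<^sub>D\<close>, and every smaller tower hanging below a terminal, is a
  retract of \<open>H\<^sub>D\<close>. Hence a spanning tree of \<open>H\<^sub>D\<close> restricts to a spanning tree of each of
  them, with the same distances, and distances add up along a descent through terminals, since
  these are cut vertices. A tree that is not FC on some copy has excess at least 1 from the root
  of that copy to one of its terminals. In a tall enough tower there is therefore a copy on which
  every tree either is FC, or can be given any prescribed excess further down, below every
  terminal of the copy. Terminals \<open>t\<close>, \<open>t'\<close> that are far apart in all FC trees, combined with a
  descent below \<open>t'\<close> that delays all other trees, then give a pair of vertices that no tree
  spans.\<close>

section \<open>Walks\<close>

text \<open>Walks of length \<open>n\<close> are the pairs in \<open>adj G ^^ n\<close>. Unlike
  paths they may repeat vertices, so they can be concatenated, split and mapped freely.\<close>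

definition adj :: "'a ugraph \<Rightarrow> ('a \<times> 'a) set" where
  "adj G = {(u, v). {u, v} \<in> edges G}"

lemma adj_iff [simp]: "(u, v) \<in> adj G \<longleftrightarrow> {u, v} \<in> edges G"
  by (simp add: adj_def)

lemma simple_graph_finite: "simple_graph G \<Longrightarrow> finite (verts G)"
  by (simp add: simple_graph_def)

lemma simple_graph_edgeD:
  assumes "simple_graph G" "{u, v} \<in> edges G"
  shows "u \<in> verts G" "v \<in> verts G" "u \<noteq> v"
proof -
  obtain a b where "{u, v} = {a, b}" "a \<in> verts G" "b \<in> verts G" "a \<noteq> b"
    using assms unfolding simple_graph_def by blast
  then show "u \<in> verts G" "v \<in> verts G" "u \<noteq> v"
    by (auto simp: doubleton_eq_iff)
qed

lemma simple_graph_edge_within: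
  assumes "simple_graph G" "e \<in> edges G" "verts G \<subseteq> V"
  shows "e \<in> {{u, v} |u v. u \<in> V \<and> v \<in> V \<and> u \<noteq> v}"
proof -
  obtain a b where "e = {a, b}" "a \<in> verts G" "b \<in> verts G" "a \<noteq> b"
    using assms(1,2) unfolding simple_graph_def by blast
  then show ?thesis using assms(3) by blast
qed

text \<open>Induction from the end of the walk: prepend the first vertex to the path found for the
  rest, and if that vertex is already on the path, cut off the loop in front of it.\<close>

lemma walk_imp_path:
  assumes "simple_graph G" "u \<in> verts G" "(u, v) \<in> adj G ^^ n"
  shows "\<exists>p. path_betw G u p v \<and> length p \<le> Suc n"
  using assms(2,3)
proof (induction n arbitrary: u)
  case 0
  then have "path_betw G u [u] v"
    by (simp add: path_betw_def path_def)
  then show ?case by force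
next
  case (Suc n)
  obtain w where w: "{u, w} \<in> edges G" "(w, v) \<in> adj G ^^ n"
    using Suc.prems(2) by (metis adj_iff relpow_Suc_D2)
  obtain p where p: "path_betw G w p v" "length p \<le> Suc n"
    using Suc.IH w simple_graph_edgeD(2)[OF assms(1)] by blast
  show ?case
  proof (cases "u \<in> set p")
    case True
    then obtain ys zs where p_eq: "p = ys @ u # zs"
      by (meson split_list)
    have "path_betw G u (u # zs) v"
      using p(1) by (auto simp: p_eq path_betw_def path_def successively_append_iff)
    then show ?thesis using p(2) p_eq by (intro exI[of _ "u # zs"]) auto
  next
    case False
    then have "path_betw G u (u # p) v"
      using p(1) w(1) Suc.prems(1)
      by (auto simp: path_betw_def path_def successively_Cons)
    then show ?thesis using p(2) by (intro exI[of _ "u # p"]) auto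
  qed
qed

lemma path_imp_walk:
  assumes "path_betw G u p v" "length p = Suc n"
  shows "(u, v) \<in> adj G ^^ n"
  using assms
proof (induction n arbitrary: u p)
  case 0
  then show ?case by (auto simp: path_betw_def length_Suc_conv)
next
  case (Suc n)
  then obtain w q where p: "p = u # w # q"
    by (auto simp: path_betw_def length_Suc_conv)
  have "(w, v) \<in> adj G ^^ n"
    using Suc.prems by (intro Suc.IH[of w "w # q"]) (auto simp: p path_betw_def path_def)
  moreover have "(u, w) \<in> adj G"
    using Suc.prems by (simp add: p path_betw_def path_def)
  ultimately show ?case by (meson relpow_Suc_I2)
qed

lemma connected_graph_iff_walks:
  assumes "simple_graph G"
  shows "connected_graph G \<longleftrightarrow>
    verts G \<noteq> {} \<and> (\<forall>u\<in>verts G. \<forall>v\<in>verts G. \<exists>n. (u, v) \<in> adj G ^^ n)"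
proof -
  have "(\<exists>p. path_betw G u p v) \<longleftrightarrow> (\<exists>n. (u, v) \<in> adj G ^^ n)" if "u \<in> verts G" for u v
  proof
    assume "\<exists>p. path_betw G u p v"
    then obtain p where p: "path_betw G u p v" by blast
    then have "length p = Suc (length p - 1)"
      by (cases p) (auto simp: path_betw_def path_def)
    then show "\<exists>n. (u, v) \<in> adj G ^^ n" using path_imp_walk[OF p] by (intro exI)
  qed (use walk_imp_path[OF assms that] in blast)
  then show ?thesis by (simp add: connected_graph_def)
qed

text \<open>Together with \<open>gdist_walk\<close> this replaces the definition through paths: from
  here on \<open>gdist\<close> is the least length of a walk.\<close>

lemma gdist_le:
  assumes "simple_graph G" "u \<in> verts G" "(u, v) \<in> adj G ^^ n"
  shows "gdist G u v \<le> n"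
proof -
  obtain p where p: "path_betw G u p v" "length p \<le> Suc n"
    using walk_imp_path[OF assms] by blast
  then have "length p = Suc (length p - 1)"
    by (cases p) (auto simp: path_betw_def path_def)
  then have "gdist G u v \<le> length p - 1"
    unfolding gdist_def using p(1) by (intro Least_le) blast
  then show ?thesis using p(2) by simp
qed

lemma gdist_walk:
  assumes "connected_graph G" "u \<in> verts G" "v \<in> verts G"
  shows "(u, v) \<in> adj G ^^ gdist G u v"
proof -
  obtain p where p: "path_betw G u p v"
    using assms unfolding connected_graph_def by blast
  then have "length p = Suc (length p - 1)"
    by (cases p) (auto simp: path_betw_def path_def)
  with p have "\<exists>n p. path_betw G u p v \<and> length p = Suc n" by blast
  then have "\<exists>p. path_betw G u p v \<and> length p = Suc (gdist G u v)"
    unfolding gdist_def by (rule LeastI_ex)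
  then show ?thesis by (elim exE conjE) (rule path_imp_walk)
qed

lemma gdist_self [simp]:
  assumes "simple_graph G" "u \<in> verts G"
  shows "gdist G u u = 0"
  using gdist_le[OF assms, of u 0] by simp

section \<open>Distances in connected spanning subgraphs\<close>

lemma adj_relpow_mono:
  assumes "edges T \<subseteq> edges G" "(u, v) \<in> adj T ^^ n"
  shows "(u, v) \<in> adj G ^^ n"
  using assms(2)
proof (induction n arbitrary: v)
  case (Suc n)
  then show ?case using assms(1) by (force elim!: relpow_Suc_E intro!: relpow_Suc_I)
qed simp

text \<open>Covers a spanning tree and the ambient graph itself alike, so each distance formula is
  proved once and then compared between the two.\<close>

definition spanning_subgraph :: "'a ugraph \<Rightarrow> 'a ugraph \<Rightarrow> bool" where
  "spanning_subgraph K G \<longleftrightarrow>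
     simple_graph K \<and> connected_graph K \<and> verts K = verts G \<and> edges K \<subseteq> edges G"

lemma spanning_tree_imp_spanning_subgraph:
  "spanning_tree T G \<Longrightarrow> spanning_subgraph T G"
  by (simp add: spanning_tree_def tree_def spanning_subgraph_def)

lemma spanning_subgraph_imp_connected:
  assumes "simple_graph G" "spanning_subgraph K G"
  shows "connected_graph G"
  using assms adj_relpow_mono[of K G]
  by (auto simp: spanning_subgraph_def connected_graph_iff_walks) blast

lemma spanning_subgraph_refl:
  assumes "simple_graph G" "spanning_subgraph K G"
  shows "spanning_subgraph G G"
  using assms spanning_subgraph_imp_connected[OF assms] by (simp add: spanning_subgraph_def)

lemma gdist_spanning_subgraph_ge:
  assumes "simple_graph G" "spanning_subgraph K G" "u \<in> verts G" "v \<in> verts G"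
  shows "gdist G u v \<le> gdist K u v"
proof (intro gdist_le adj_relpow_mono[of K G])
  show "(u, v) \<in> adj K ^^ gdist K u v"
    using assms by (intro gdist_walk) (auto simp: spanning_subgraph_def)
qed (use assms in \<open>auto simp: spanning_subgraph_def\<close>)


section \<open>Restriction to a retract\<close>

text \<open>For injective \<open>f\<close> this is the part of \<open>K\<close> inside the image of
  \<open>f\<close>, written with the names that its vertices have before the embedding.\<close>

definition pullback :: "('a \<Rightarrow> 'b) \<Rightarrow> 'b ugraph \<Rightarrow> 'a ugraph" where
  "pullback f K = \<lparr>verts = f -` verts K, edges = {e. f ` e \<in> edges K}\<rparr>"

lemma verts_pullback [simp]: "verts (pullback f K) = f -` verts K"
  and edges_pullback [simp]: "edges (pullback f K) = {e. f ` e \<in> edges K}"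
  by (simp_all add: pullback_def)

text \<open>The retraction \<open>\<rho>\<close> contracts every edge outside the image of \<open>f\<close>, so it turns walks into
  walks that are no longer.\<close>

definition retracts :: "('a \<Rightarrow> 'b) \<Rightarrow> ('b \<Rightarrow> 'a) \<Rightarrow> 'b ugraph \<Rightarrow> bool" where
  "retracts f \<rho> K \<longleftrightarrow> (\<forall>x. \<rho> (f x) = x) \<and>
     (\<forall>u v. {u, v} \<in> edges K \<longrightarrow> \<rho> u = \<rho> v \<or> f (\<rho> u) = u \<and> f (\<rho> v) = v)"

lemma retracts_mono: "retracts f \<rho> K \<Longrightarrow> edges T \<subseteq> edges K \<Longrightarrow> retracts f \<rho> T"
  unfolding retracts_def by blast

lemma retracts_inverse: "retracts f \<rho> K \<Longrightarrow> \<rho> (f x) = x"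
  unfolding retracts_def by blast

lemma retracts_imp_inj: "retracts f \<rho> K \<Longrightarrow> inj f"
  by (metis injI retracts_inverse)

lemma walk_retract:
  assumes "retracts f \<rho> K" "(u, v) \<in> adj K ^^ n"
  shows "\<exists>m\<le>n. (\<rho> u, \<rho> v) \<in> adj (pullback f K) ^^ m"
  using assms(2)
proof (induction n arbitrary: v)
  case 0
  then show ?case by auto
next
  case (Suc n)
  obtain w where w: "(u, w) \<in> adj K ^^ n" "{w, v} \<in> edges K"
    using Suc.prems by auto
  obtain m where m: "m \<le> n" "(\<rho> u, \<rho> w) \<in> adj (pullback f K) ^^ m"
    using Suc.IH w(1) by blast
  from w(2) assms(1) consider "\<rho> w = \<rho> v" | "f (\<rho> w) = w" "f (\<rho> v) = v"
    unfolding retracts_def by blast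
  then show ?case
  proof cases
    case 1
    then show ?thesis using m by (metis le_SucI)
  next
    case 2
    then have "(\<rho> w, \<rho> v) \<in> adj (pullback f K)" using w(2) by simp
    then have "(\<rho> u, \<rho> v) \<in> adj (pullback f K) ^^ Suc m"
      using m(2) by (meson relpow_Suc_I)
    then show ?thesis using m(1) by (meson Suc_le_mono)
  qed
qed

lemma walk_pullback:
  assumes "(x, y) \<in> adj (pullback f K) ^^ n"
  shows "(f x, f y) \<in> adj K ^^ n"
  using assms
proof (induction n arbitrary: y)
  case (Suc n)
  then obtain z where "(x, z) \<in> adj (pullback f K) ^^ n" "{f z, f y} \<in> edges K"
    by (auto elim!: relpow_Suc_E)
  then show ?case using Suc.IH by (intro relpow_Suc_I) auto
qed simp

lemma simple_graph_pullback:
  assumes "inj f" "simple_graph K"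
  shows "simple_graph (pullback f K)"
  unfolding simple_graph_def
proof
  show "finite (verts (pullback f K))"
    using assms by (simp add: simple_graph_def finite_vimageI)
  show "edges (pullback f K) \<subseteq> {{u, v} |u v. u \<in> verts (pullback f K) \<and>
    v \<in> verts (pullback f K) \<and> u \<noteq> v}"
  proof
    fix e assume "e \<in> edges (pullback f K)"
    then have "f ` e \<in> edges K" by simp
    then obtain a b where ab: "f ` e = {a, b}" "a \<in> verts K" "b \<in> verts K" "a \<noteq> b"
      using assms(2) unfolding simple_graph_def by blast
    then have "a \<in> f ` e" "b \<in> f ` e" by simp_all
    then obtain x y where xy: "x \<in> e" "y \<in> e" "f x = a" "f y = b" by auto
    then have "f ` e = f ` {x, y}" using ab(1) by simp
    then have "e = {x, y}" by (simp only: inj_image_eq_iff[OF assms(1)])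
    then show "e \<in> {{u, v} |u v. u \<in> verts (pullback f K) \<and> v \<in> verts (pullback f K) \<and> u \<noteq> v}"
      using xy ab by auto
  qed
qed

text \<open>A walk of \<open>K\<close> between two vertices of the image may leave the image, but
  the retraction pushes it back inside; hence the restriction stays connected. The vertex
  \<open>x\<close> makes it nonempty.\<close>

lemma spanning_subgraph_pullback:
  assumes "retracts f \<rho> G" "spanning_subgraph K G" "x \<in> verts (pullback f G)"
  shows "spanning_subgraph (pullback f K) (pullback f G)"
proof -
  have K: "simple_graph K" "connected_graph K" "verts K = verts G" "edges K \<subseteq> edges G"
    using assms(2) by (auto simp: spanning_subgraph_def)
  have ret: "retracts f \<rho> K" using retracts_mono assms(1) K(4) by blast
  have simple: "simple_graph (pullback f K)"
    using simple_graph_pullback[OF retracts_imp_inj[OF ret] K(1)] .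
  have "\<exists>m. (u, v) \<in> adj (pullback f K) ^^ m" if uv: "f u \<in> verts K" "f v \<in> verts K" for u v
  proof -
    obtain n where "(f u, f v) \<in> adj K ^^ n"
      using gdist_walk[OF K(2) uv] by blast
    from walk_retract[OF ret this] show ?thesis by (auto simp: retracts_inverse[OF ret])
  qed
  then have "connected_graph (pullback f K)"
    using assms(3) K(3) by (auto simp: connected_graph_iff_walks[OF simple])
  then show ?thesis using simple K by (auto simp: spanning_subgraph_def)
qed

text \<open>The retraction turns a shortest walk of \<open>K\<close> into one inside the image that
  is no longer, and \<open>f\<close> carries walks of the restriction back to
  \<open>K\<close>.\<close>

lemma gdist_pullback:
  assumes "retracts f \<rho> G" "spanning_subgraph K G" "f x \<in> verts G" "f y \<in> verts G"
  shows "gdist (pullback f K) x y = gdist K (f x) (f y)"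
proof -
  have K: "simple_graph K" "connected_graph K" "verts K = verts G" "edges K \<subseteq> edges G"
    using assms(2) by (auto simp: spanning_subgraph_def)
  have ret: "retracts f \<rho> K" using retracts_mono assms(1) K(4) by blast
  have P: "spanning_subgraph (pullback f K) (pullback f G)"
    using spanning_subgraph_pullback[OF assms(1,2)] assms(3) by simp
  show ?thesis
  proof (rule antisym)
    have "(f x, f y) \<in> adj K ^^ gdist K (f x) (f y)"
      using K assms by (intro gdist_walk) auto
    from walk_retract[OF ret this] obtain m
      where m: "m \<le> gdist K (f x) (f y)" "(x, y) \<in> adj (pullback f K) ^^ m"
      by (auto simp: retracts_inverse[OF ret])
    have "gdist (pullback f K) x y \<le> m"
      using P assms(3) K(3) m(2) by (intro gdist_le) (auto simp: spanning_subgraph_def)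
    then show "gdist (pullback f K) x y \<le> gdist K (f x) (f y)" using m(1) by simp
  next
    have "(x, y) \<in> adj (pullback f K) ^^ gdist (pullback f K) x y"
      using P assms(3,4) K(3) by (intro gdist_walk) (auto simp: spanning_subgraph_def)
    then show "gdist K (f x) (f y) \<le> gdist (pullback f K) x y"
      using K assms(3) by (intro gdist_le[OF _ _ walk_pullback]) auto
  qed
qed

lemma cycle_pullback:
  assumes "inj f" "cycle (pullback f K) p"
  shows "cycle K (map f p)"
proof -
  have p: "length p \<ge> 3" "distinct p" "set p \<subseteq> verts (pullback f K)"
    "successively (\<lambda>u v. {u, v} \<in> edges (pullback f K)) p"
    "{last p, hd p} \<in> edges (pullback f K)" "p \<noteq> []"
    using assms(2) by (auto simp: cycle_def path_def)
  show ?thesis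
    using p assms(1)
    by (auto simp: cycle_def path_def distinct_map successively_map last_map hd_map
        intro: inj_on_subset)
qed

lemma spanning_tree_pullback:
  assumes "retracts f \<rho> G" "spanning_tree T G" "x \<in> verts (pullback f G)"
  shows "spanning_tree (pullback f T) (pullback f G)"
proof -
  have "spanning_subgraph (pullback f T) (pullback f G)"
    by (rule spanning_subgraph_pullback[OF assms(1) spanning_tree_imp_spanning_subgraph[OF assms(2)] assms(3)])
  moreover have "\<nexists>p. cycle (pullback f T) p"
    using cycle_pullback[OF retracts_imp_inj[OF assms(1)]] assms(2)
    by (auto simp: spanning_tree_def tree_def)
  ultimately show ?thesis by (simp add: spanning_subgraph_def spanning_tree_def tree_def)
qed

section \<open>Cut vertices\<close>

text \<open>As long as the walk is in \<open>A\<close> and not at \<open>x\<close>, it is outside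
  \<open>B\<close>, so its next edge lies in \<open>A\<close>. It can therefore reach
  \<open>B\<close> only by visiting \<open>x\<close>, where it is split.\<close>

lemma walk_through_cut_vertex:
  assumes "\<And>u v. {u, v} \<in> edges K \<Longrightarrow> {u, v} \<subseteq> A \<or> {u, v} \<subseteq> B" "A \<inter> B \<subseteq> {x}"
    and "u \<in> A" "v \<in> B" "(u, v) \<in> adj K ^^ n"
  shows "\<exists>i j. i + j = n \<and> (u, x) \<in> adj K ^^ i \<and> (x, v) \<in> adj K ^^ j"
  using assms(3-)
proof (induction n arbitrary: u)
  case 0
  then have "u = x" "v = x" using assms(2) by auto
  then show ?case by simp
next
  case (Suc n)
  show ?case
  proof (cases "u = x")
    case True
    then show ?thesis using Suc.prems(3)
      by (intro exI[of _ "0::nat"] exI[of _ "Suc n"]) simp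
  next
    case False
    obtain w where w: "{u, w} \<in> edges K" "(w, v) \<in> adj K ^^ n"
      using Suc.prems(3) by (metis adj_iff relpow_Suc_D2)
    have "w \<in> A" using assms(1)[OF w(1)] assms(2) False Suc.prems(1) by auto
    then obtain i j where ij: "i + j = n" "(w, x) \<in> adj K ^^ i" "(x, v) \<in> adj K ^^ j"
      using Suc.IH Suc.prems(2) w(2) by blast
    have "(u, x) \<in> adj K ^^ Suc i"
      using w(1) ij(2) by (meson adj_iff relpow_Suc_I2)
    then show ?thesis using ij by (metis add_Suc)
  qed
qed

lemma gdist_cut_vertex:
  assumes "\<And>u v. {u, v} \<in> edges K \<Longrightarrow> {u, v} \<subseteq> A \<or> {u, v} \<subseteq> B" "A \<inter> B \<subseteq> {x}"
    and "simple_graph K" "connected_graph K" "u \<in> verts K" "v \<in> verts K" "x \<in> verts K"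
    and "u \<in> A" "v \<in> B"
  shows "gdist K u v = gdist K u x + gdist K x v"
proof (rule antisym)
  show "gdist K u v \<le> gdist K u x + gdist K x v"
    using gdist_walk[of K u x] gdist_walk[of K x v] assms
    by (intro gdist_le) (auto simp: relpow_add)
next
  obtain i j where "i + j = gdist K u v" "(u, x) \<in> adj K ^^ i" "(x, v) \<in> adj K ^^ j"
    using walk_through_cut_vertex[OF assms(1,2) assms(8,9) gdist_walk] assms(4-6) by blast
  moreover from this have "gdist K u x \<le> i" "gdist K x v \<le> j"
    using gdist_le[OF assms(3)] assms(5,7) by simp_all
  ultimately show "gdist K u x + gdist K x v \<le> gdist K u v" by linarith
qed


section \<open>The tree of gadgets\<close>

lemma simple_graph_map_graph:
  assumes "inj f" "simple_graph K"
  shows "simple_graph (map_graph f K)"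
proof -
  have "f ` e \<in> {{u, v} |u v. u \<in> f ` verts K \<and> v \<in> f ` verts K \<and> u \<noteq> v}"
    if e: "e \<in> edges K" for e
  proof -
    obtain a b where "e = {a, b}" "a \<in> verts K" "b \<in> verts K" "a \<noteq> b"
      using assms(2) e unfolding simple_graph_def by blast
    then have "f ` e = {f a, f b}" "f a \<in> f ` verts K" "f b \<in> f ` verts K" "f a \<noteq> f b"
      using assms(1) by (auto simp: inj_eq)
    then show ?thesis by blast
  qed
  then show ?thesis using assms(2) by (auto simp: simple_graph_def map_graph_def)
qed

locale gadget_tower =
  fixes G :: "'a ugraph" and r :: 'a and S :: "'a set"
  assumes gadget: "gadget G r S"
begin

abbreviation tower :: "nat \<Rightarrow> ('a list \<times> 'a) ugraph" where
  "tower \<equiv> gadget_graph G r S"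

abbreviation base :: "('a list \<times> 'a) ugraph \<Rightarrow> 'a ugraph" where
  "base \<equiv> pullback (Pair [])"

abbreviation branch :: "'a \<Rightarrow> ('a list \<times> 'a) ugraph \<Rightarrow> ('a list \<times> 'a) ugraph" where
  "branch t \<equiv> pullback (attach r t)"

lemma G_simple: "simple_graph G" and r_in: "r \<in> verts G" and finite_S: "finite S"
  and S_sub: "t \<in> S \<Longrightarrow> t \<in> verts G" and r_neq: "t \<in> S \<Longrightarrow> r \<noteq> t"
  using gadget by (auto simp: gadget_def intro: card_ge_0_finite)

lemma attach_root [simp]: "attach r t ([], r) = ([], t)"
  by (simp add: attach_def)

lemma range_attachD:
  assumes "u \<in> range (attach r t)"
  shows "u = ([], t) \<or> (\<exists>p v. u = (t # p, v))"
  using assms by (auto simp: attach_def split: if_splits)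

lemma simple_tower: "simple_graph (tower D)"
proof (induction D)
  case 0
  then show ?case by (simp add: simple_graph_def)
next
  case (Suc D)
  have base: "simple_graph (map_graph (Pair []) G :: ('a list \<times> 'a) ugraph)"
    by (intro simple_graph_map_graph G_simple) (simp add: inj_on_def)
  have branch: "simple_graph (map_graph (attach r t) (tower D))" if "t \<in> S" for t
    using simple_graph_map_graph[OF inj_attach[OF r_neq[OF that]] Suc] .
  show ?case
    unfolding simple_graph_def
  proof (intro conjI subsetI)
    show "finite (verts (tower (Suc D)))"
      using finite_S base branch by (simp add: simple_graph_finite)
    fix e assume "e \<in> edges (tower (Suc D))"
    then consider "e \<in> edges (map_graph (Pair []) G :: ('a list \<times> 'a) ugraph)"
      | t where "t \<in> S" "e \<in> edges (map_graph (attach r t) (tower D))"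
      by auto
    then show "e \<in> {{u, v} |u v. u \<in> verts (tower (Suc D)) \<and> v \<in> verts (tower (Suc D)) \<and> u \<noteq> v}"
    proof cases
      case 1
      then show ?thesis by (rule simple_graph_edge_within[OF base]) simp
    next
      case 2
      show ?thesis by (rule simple_graph_edge_within[OF branch[OF 2(1)] 2(2)]) (use 2(1) in auto)
    qed
  qed
qed

section \<open>The root copy and the branches inside the tower\<close>

lemma tower_edge_cases:
  assumes "e \<in> edges (tower (Suc D))"
  obtains (base) e' where "e' \<in> edges G" "e = Pair [] ` e'"
  | (branch) t e' where "t \<in> S" "e' \<in> edges (tower D)" "e = attach r t ` e'"
  using assms by (auto simp: map_graph_def)

lemma base_tower: "base (tower (Suc D)) = G"
proof -
  have "e \<in> edges G" if e: "Pair [] ` e \<in> edges (tower (Suc D))" for e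
    using e
  proof (cases rule: tower_edge_cases)
    case (base e')
    then show ?thesis by (simp add: inj_image_eq_iff inj_on_def)
  next
    case (branch t e')
    \<comment> \<open>A branch shares only its root with the root copy, so an edge of a branch,
      having two distinct ends, cannot lie in the root copy.\<close>
    obtain a b where ab: "e' = {a, b}" "a \<noteq> b"
      using simple_tower[of D] branch(2) by (auto simp: simple_graph_def)
    have "attach r t a \<in> range (Pair [])" "attach r t b \<in> range (Pair [])"
      using branch(3) ab by blast+
    then show ?thesis using ab(2) unfolding attach_meets_root_copy by simp
  qed
  moreover have "v \<in> verts G" if "([], v) \<in> verts (tower (Suc D))" for v
    using that S_sub by (auto simp: map_graph_def attach_def split: if_splits)
  moreover have "([], v) \<in> verts (tower (Suc D))" if "v \<in> verts G" for v
    using that by (simp add: map_graph_def)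
  moreover have "Pair [] ` e \<in> edges (tower (Suc D))" if "e \<in> edges G" for e
    using that by (simp add: map_graph_def)
  ultimately show ?thesis
    by (intro ugraph.equality) (auto simp del: gadget_graph.simps)
qed

lemma branch_tower:
  assumes t: "t \<in> S"
  shows "branch t (tower (Suc D)) = tower D"
proof -
  have "e \<in> edges (tower D)" if e: "attach r t ` e \<in> edges (tower (Suc D))" for e
    using e
  proof (cases rule: tower_edge_cases)
    case (base e')
    obtain a b where ab: "e' = {a, b}" "a \<noteq> b"
      using G_simple base(1) by (auto simp: simple_graph_def)
    \<comment> \<open>The same overlap seen from the branch: an edge of the root copy inside the
      branch would collapse to the single vertex \<open>([], t)\<close>.\<close>
    have "x = ([], r)" if "x \<in> e" for x
    proof -
      have "attach r t x \<in> range (Pair [])" using base that by blast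
      then show ?thesis unfolding attach_meets_root_copy .
    qed
    then have "attach r t ` e \<subseteq> {([], t)}" by force
    then show ?thesis using base(2) ab by auto
  next
    case (branch t' e')
    \<comment> \<open>One common vertex already forces \<open>t' = t\<close>, since different
      branches are disjoint.\<close>
    have "e' \<noteq> {}" using simple_tower[of D] branch(2) by (auto simp: simple_graph_def)
    then obtain y where "y \<in> e'" by blast
    then have "attach r t' y \<in> attach r t ` e" unfolding branch(3) by (rule imageI)
    then obtain x where "attach r t' y = attach r t x" by (rule imageE)
    then have "t' = t" using attach_disjoint by metis
    then show ?thesis using branch inj_attach[OF r_neq[OF t]] by (simp add: inj_image_eq_iff)
  qed
  moreover have "x \<in> verts (tower D)" if x: "attach r t x \<in> verts (tower (Suc D))" for x
  proof -
    consider "attach r t x \<in> range (Pair [])"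
      | t' y where "attach r t x = attach r t' y" "y \<in> verts (tower D)"
      using x by (auto simp: map_graph_def)
    then show ?thesis
    proof cases
      case 1
      then show ?thesis
        unfolding attach_meets_root_copy using root_in_gadget_graph[OF gadget] by simp
    next
      case 2
      then have "t' = t" using attach_disjoint by metis
      then show ?thesis using 2 inj_attach[OF r_neq[OF t]] by (simp add: inj_eq)
    qed
  qed
  moreover have "attach r t x \<in> verts (tower (Suc D))" if "x \<in> verts (tower D)" for x
    using that t by (auto simp: map_graph_def)
  moreover have "attach r t ` e \<in> edges (tower (Suc D))" if "e \<in> edges (tower D)" for e
    using that t by (auto simp: map_graph_def)
  ultimately show ?thesis
    by (intro ugraph.equality) (auto simp del: gadget_graph.simps)
qed

lemma attach_in_tower:
  "t \<in> S \<Longrightarrow> attach r t x \<in> verts (tower (Suc D)) \<longleftrightarrow> x \<in> verts (tower D)"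
  using branch_tower[of t D] by (metis verts_pullback vimage_eq)

lemma base_in_tower: "([], v) \<in> verts (tower (Suc D)) \<longleftrightarrow> v \<in> verts G"
  using base_tower[of D] by (metis verts_pullback vimage_eq)

text \<open>The retraction sends every vertex below a terminal \<open>t\<close> to \<open>t\<close>,
  which is the first entry of its address; each branch collapses to a point.\<close>

lemma retracts_base:
  "retracts (Pair []) (\<lambda>(p, v). if p = [] then v else hd p) (tower (Suc D))"
  unfolding retracts_def
proof (intro conjI allI impI)
  let ?\<rho> = "\<lambda>(p :: 'a list, v). if p = [] then v else hd p"
  fix u v
  assume "{u, v} \<in> edges (tower (Suc D))"
  then show "?\<rho> u = ?\<rho> v \<or> ([], ?\<rho> u) = u \<and> ([], ?\<rho> v) = v"
  proof (cases rule: tower_edge_cases)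
    case (base e')
    then have "u \<in> range (Pair [])" "v \<in> range (Pair [])" by blast+
    then show ?thesis by auto
  next
    case (branch t e')
    then have "u \<in> range (attach r t)" "v \<in> range (attach r t)" by blast+
    then show ?thesis by (auto dest!: range_attachD)
  qed
qed simp

text \<open>Everything outside the branch is sent to the root of the branch. The vertex
  \<open>([], t)\<close> has an empty address and is sent there too, which is correct because it is
  that root.\<close>

lemma retracts_branch:
  "retracts (attach r t) (\<lambda>(p, v). if p \<noteq> [] \<and> hd p = t then (tl p, v) else ([], r)) (tower (Suc D))"
  unfolding retracts_def
proof (intro conjI allI impI)
  let ?\<rho> = "\<lambda>(p, v). if p \<noteq> [] \<and> hd p = t then (tl p, v) else ([], r)"
  show attach: "?\<rho> (attach r t x) = x" for x
    by (cases x) (simp add: attach_def)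
  fix u v
  assume "{u, v} \<in> edges (tower (Suc D))"
  then show "?\<rho> u = ?\<rho> v \<or> attach r t (?\<rho> u) = u \<and> attach r t (?\<rho> v) = v"
  proof (cases rule: tower_edge_cases)
    case (base e')
    then have "u \<in> range (Pair [])" "v \<in> range (Pair [])" by blast+
    then show ?thesis by auto
  next
    case (branch t' e')
    then have uv: "u \<in> range (attach r t')" "v \<in> range (attach r t')" by blast+
    show ?thesis
    proof (cases "t' = t")
      case True
      then have "attach r t (?\<rho> u) = u" "attach r t (?\<rho> v) = v"
        using uv attach by (metis (no_types, lifting) rangeE)+
      then show ?thesis by blast
    next
      case False
      then have "?\<rho> u = ([], r)" "?\<rho> v = ([], r)"
        using uv by (auto dest!: range_attachD)
      then show ?thesis by simp
    qed
  qed
qed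

lemma spanning_subgraph_branch:
  assumes "spanning_subgraph K (tower (Suc D))" "t \<in> S"
  shows "spanning_subgraph (branch t K) (tower D)"
  using spanning_subgraph_pullback[OF retracts_branch[where t = t] assms(1), where x = "([], r)"]
    root_in_gadget_graph[OF gadget, of D]
  by (simp only: branch_tower[OF assms(2)] simp_thms)

lemma spanning_tree_branch:
  assumes "spanning_tree T (tower (Suc D))" "t \<in> S"
  shows "spanning_tree (branch t T) (tower D)"
  using spanning_tree_pullback[OF retracts_branch[where t = t] assms(1), where x = "([], r)"]
    root_in_gadget_graph[OF gadget, of D]
  by (simp only: branch_tower[OF assms(2)] simp_thms)

lemma spanning_tree_base:
  assumes "spanning_tree T (tower (Suc D))"
  shows "spanning_tree (base T) G"
  using spanning_tree_pullback[OF retracts_base assms, where x = r] r_in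
  by (simp only: base_tower simp_thms)

lemma gdist_branch:
  assumes "spanning_subgraph K (tower (Suc D))" "t \<in> S" "x \<in> verts (tower D)" "y \<in> verts (tower D)"
  shows "gdist K (attach r t x) (attach r t y) = gdist (branch t K) x y"
  using gdist_pullback[OF retracts_branch assms(1)] assms by (simp only: attach_in_tower)

text \<open>The terminal \<open>t\<close> separates the branch hanging at it from the rest of the
  tower.\<close>

lemma gdist_base_branch:
  assumes K: "spanning_subgraph K (tower (Suc D))"
    and t: "t \<in> S" and a: "a \<in> verts G" and x: "x \<in> verts (tower D)"
  shows "gdist K ([], a) (attach r t x) = gdist (base K) a t + gdist (branch t K) ([], r) x"
proof -
  \<comment> \<open>\<open>?A\<close> is all that is not strictly below \<open>t\<close>, and
    \<open>?B\<close> is the branch with its root; both contain the cut vertex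
    \<open>([], t)\<close>.\<close>
  let ?A = "{(p, v). p = [] \<or> hd p \<noteq> t}" and ?B = "range (attach r t)"
  have edge: "{u, v} \<subseteq> ?A \<or> {u, v} \<subseteq> ?B" if "{u, v} \<in> edges K" for u v
  proof -
    have "{u, v} \<in> edges (tower (Suc D))"
      using K that by (auto simp: spanning_subgraph_def simp del: gadget_graph.simps)
    then show ?thesis
    proof (cases rule: tower_edge_cases)
      case (base e')
      then have "u \<in> range (Pair [])" "v \<in> range (Pair [])" by blast+
      then show ?thesis by auto
    next
      case (branch t' e')
      then have uv: "u \<in> range (attach r t')" "v \<in> range (attach r t')" by blast+
      show ?thesis
      proof (cases "t' = t")
        case False
        then have "u \<in> ?A" "v \<in> ?A" using uv by (auto dest!: range_attachD)
        then show ?thesis by blast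
      qed (use uv in simp)
    qed
  qed
  have cut: "?A \<inter> ?B \<subseteq> {([], t)}" by (auto simp: attach_def split: if_splits)
  have "gdist K ([], a) (attach r t x) =
      gdist K ([], a) ([], t) + gdist K ([], t) (attach r t x)"
  proof (rule gdist_cut_vertex[OF edge cut])
    have "verts K = verts (tower (Suc D))" using K by (simp add: spanning_subgraph_def)
    then show "([], a) \<in> verts K" "attach r t x \<in> verts K" "([], t) \<in> verts K"
      using a t x S_sub by (simp_all only: attach_in_tower base_in_tower)
  qed (use K in \<open>simp_all add: spanning_subgraph_def\<close>)
  also have "gdist K ([], a) ([], t) = gdist (base K) a t"
    using gdist_pullback[OF retracts_base K] a S_sub[OF t] by (simp only: base_in_tower)
  also have "gdist K ([], t) (attach r t x) = gdist (branch t K) ([], r) x"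
    using gdist_branch[OF K t root_in_gadget_graph[OF gadget] x] by simp
  finally show ?thesis .
qed


section \<open>Descending along terminals\<close>

text \<open>Where the descent along the terminals in \<open>p\<close> ends: the root of the copy
  reached, or a terminal of the lowest level if the descent uses all levels.\<close>

primrec node :: "'a list \<Rightarrow> 'a list \<times> 'a" where
  "node [] = ([], r)"
| "node (t # p) = attach r t (node p)"

primrec subtower :: "'a list \<Rightarrow> ('a list \<times> 'a) ugraph \<Rightarrow> ('a list \<times> 'a) ugraph" where
  "subtower [] K = K"
| "subtower (t # p) K = subtower p (branch t K)"

text \<open>Excess is measured only along descents from the top root, because there it is additive
  (\<open>late_append\<close>).\<close>

definition late :: "nat \<Rightarrow> ('a list \<times> 'a) ugraph \<Rightarrow> 'a list \<Rightarrow> nat \<Rightarrow> bool" where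
  "late D T p k \<longleftrightarrow> gdist (tower D) ([], r) (node p) + k \<le> gdist T ([], r) (node p)"

lemma node_in_tower: "p \<in> lists S \<Longrightarrow> length p \<le> D \<Longrightarrow> node p \<in> verts (tower D)"
proof (induction p arbitrary: D)
  case Nil
  then show ?case using root_in_gadget_graph[OF gadget] by simp
next
  case (Cons t p)
  then obtain D' where "D = Suc D'" by (cases D) auto
  with Cons show ?case by (simp add: attach_in_tower del: gadget_graph.simps)
qed

lemma subtower_tower:
  "p \<in> lists S \<Longrightarrow> length p \<le> D \<Longrightarrow> subtower p (tower D) = tower (D - length p)"
proof (induction p arbitrary: D)
  case (Cons t p)
  then obtain D' where "D = Suc D'" by (cases D) auto
  with Cons show ?case by (simp add: branch_tower del: gadget_graph.simps)
qed simp

lemma spanning_tree_subtower: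
  "spanning_tree T (tower D) \<Longrightarrow> p \<in> lists S \<Longrightarrow> length p \<le> D \<Longrightarrow>
    spanning_tree (subtower p T) (tower (D - length p))"
proof (induction p arbitrary: D T)
  case (Cons t p)
  then obtain D' where "D = Suc D'" by (cases D) auto
  with Cons show ?case by (simp add: spanning_tree_branch del: gadget_graph.simps)
qed simp

text \<open>Every terminal on the way is a cut vertex. The induction strips the first one, applying
  \<open>gdist_base_branch\<close> to the descents \<open>p\<close> and \<open>p @ q\<close>
  alike.\<close>

lemma gdist_node_append:
  "spanning_subgraph K (tower D) \<Longrightarrow> p \<in> lists S \<Longrightarrow> q \<in> lists S \<Longrightarrow> length p + length q \<le> D \<Longrightarrow>
    gdist K ([], r) (node (p @ q)) = gdist K ([], r) (node p) + gdist (subtower p K) ([], r) (node q)"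
proof (induction p arbitrary: D K)
  case Nil
  then have "simple_graph K" "([], r) \<in> verts K"
    using root_in_gadget_graph[OF gadget] by (auto simp: spanning_subgraph_def)
  then show ?case by simp
next
  case (Cons t p)
  then obtain D' where D: "D = Suc D'" by (cases D) auto
  have *: "gdist K ([], r) (node (t # p')) = gdist (base K) r t + gdist (branch t K) ([], r) (node p')"
    if "p' \<in> lists S" "length p' \<le> D'" for p'
    using gdist_base_branch[OF Cons.prems(1)[unfolded D], of t r "node p'"] Cons.prems(2) r_in that
      node_in_tower[OF that]
    by simp
  have "gdist (branch t K) ([], r) (node (p @ q)) =
      gdist (branch t K) ([], r) (node p) + gdist (subtower p (branch t K)) ([], r) (node q)"
    using Cons.prems D by (intro Cons.IH spanning_subgraph_branch) auto
  then show ?case using *[of p] *[of "p @ q"] Cons.prems D by simp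
qed

text \<open>Connectedness of the tower is not derived from its construction; wherever it is used, a
  spanning tree is at hand and provides it.\<close>

lemma tower_spanning_subgraph:
  "spanning_tree T (tower D) \<Longrightarrow> spanning_subgraph (tower D) (tower D)"
  using spanning_subgraph_refl simple_tower spanning_tree_imp_spanning_subgraph by blast

lemma late_append:
  assumes T: "spanning_tree T (tower D)" and "p \<in> lists S" "q \<in> lists S" "length p + length q \<le> D"
    and "late D T p k" "late (D - length p) (subtower p T) q l"
  shows "late D T (p @ q) (k + l)"
proof -
  have "gdist K ([], r) (node (p @ q)) = gdist K ([], r) (node p) + gdist (subtower p K) ([], r) (node q)"
    if "K \<in> {T, tower D}" for K
    using that gdist_node_append[of K D p q] assms tower_spanning_subgraph[OF T]
      spanning_tree_imp_spanning_subgraph[OF T] by auto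
  then show ?thesis
    using assms by (simp add: late_def subtower_tower)
qed

text \<open>Guarantees that prolonging a descent never loses excess gained before.\<close>

lemma late_0:
  assumes "spanning_tree T (tower D)" "p \<in> lists S" "length p \<le> D"
  shows "late D T p 0"
  using assms gdist_spanning_subgraph_ge[OF simple_tower spanning_tree_imp_spanning_subgraph]
  by (simp add: late_def node_in_tower root_in_gadget_graph[OF gadget])

section \<open>Excess from copies on which a tree is not FC\<close>

primrec FC_levels :: "nat \<Rightarrow> ('a list \<times> 'a) ugraph \<Rightarrow> bool" where
  "FC_levels 0 T \<longleftrightarrow> True"
| "FC_levels (Suc n) T \<longleftrightarrow> FC_tree G r S (base T) \<and> (\<forall>t\<in>S. FC_levels n (branch t T))"

lemma FC_levels_mono: "FC_levels n T \<Longrightarrow> m \<le> n \<Longrightarrow> FC_levels m T"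
proof (induction n arbitrary: m T)
  case (Suc n)
  then show ?case by (cases m) auto
qed simp

lemma FC_levels_subtower:
  "FC_levels n T \<Longrightarrow> p \<in> lists S \<Longrightarrow> length p + m \<le> n \<Longrightarrow> FC_levels m (subtower p T)"
proof (induction p arbitrary: n T)
  case Nil
  then show ?case using FC_levels_mono by auto
next
  case (Cons t p)
  then obtain n' where "n = Suc n'" by (cases n) auto
  with Cons show ?case by auto
qed

text \<open>On a copy where the tree is not FC, some distance from root to terminal differs from
  that in \<open>G\<close>. It can only be larger, hence larger by at least 1, and the copies above
  it cost nothing.\<close>

lemma late_if_not_FC_levels:
  "spanning_tree T (tower D) \<Longrightarrow> n \<le> D \<Longrightarrow> \<not> FC_levels n T \<Longrightarrow>
    \<exists>p\<in>lists S. length p \<le> n \<and> late D T p 1"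
proof (induction n arbitrary: D T)
  case (Suc n)
  obtain D' where D: "D = Suc D'" using Suc.prems(2) by (cases D) auto
  note T = Suc.prems(1)
  have step: "gdist K ([], r) (node (t # p)) = gdist (base K) r t + gdist (branch t K) ([], r) (node p)"
    if "K \<in> {T, tower D}" "t \<in> S" "p \<in> lists S" "length p \<le> D'" for K t p
    using that gdist_base_branch[of K D' t r "node p"] r_in node_in_tower
      tower_spanning_subgraph[OF T] spanning_tree_imp_spanning_subgraph[OF T] D by auto
  have base: "gdist G r t \<le> gdist (base T) r t" if "t \<in> S" for t
    using that r_in S_sub spanning_tree_base T D
    by (intro gdist_spanning_subgraph_ge G_simple spanning_tree_imp_spanning_subgraph) auto
  show ?case
  proof (cases "FC_tree G r S (base T)")
    case False
    then obtain t where t: "t \<in> S" "gdist (base T) r t \<noteq> gdist G r t"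
      using spanning_tree_base T D by (auto simp: FC_tree_def)
    \<comment> \<open>The excess arises between \<open>r\<close> and \<open>t\<close> in the top
      copy, so the descent stops at \<open>t\<close> and the part below contributes nothing.\<close>
    have "late D' (branch t T) [] 0"
      using t(1) T D by (intro late_0 spanning_tree_branch) auto
    then have "late D T [t] 1"
      using step[of _ t "[]"] base[OF t(1)] t
      by (simp add: late_def D base_tower branch_tower del: gadget_graph.simps)
    then show ?thesis using t(1) by (intro bexI[of _ "[t]"]) auto
  next
    case True
    then obtain t where t: "t \<in> S" "\<not> FC_levels n (branch t T)" using Suc.prems(3) by auto
    obtain p where p: "p \<in> lists S" "length p \<le> n" "late D' (branch t T) p 1"
      using Suc.IH[OF spanning_tree_branch] T D t Suc.prems(2) by (metis Suc_le_mono)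
    then have "late D T (t # p) 1"
      using step[of _ t p] base[OF t(1)] t Suc.prems(2)
      by (simp add: late_def D base_tower branch_tower del: gadget_graph.simps)
    then show ?thesis using t(1) p by (intro bexI[of _ "t # p"]) auto
  qed
qed simp

text \<open>The list \<open>js\<close> is a schedule: each entry names the tree to be delayed by 1
  in the next piece of the descent, a piece of at most \<open>N\<close> levels. The head of the list
  is served last, below the descent built for the tail.\<close>

lemma accumulate_late:
  assumes T: "\<And>i. i \<in> I \<Longrightarrow> spanning_tree (T i) (tower D)"
    and not_FC: "\<And>p i. p \<in> lists S \<Longrightarrow> length p + N \<le> M \<Longrightarrow> i \<in> set js \<Longrightarrow> \<not> FC_levels N (subtower p (T i))"
    and "M \<le> D" "length js * N \<le> M" "set js \<subseteq> I"
  shows "\<exists>q\<in>lists S. length q \<le> length js * N \<and> (\<forall>i\<in>I. late D (T i) q (count_list js i))"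
  using assms(2,4,5)
proof (induction js)
  case Nil
  then show ?case using T late_0 by (intro bexI[of _ "[]"]) auto
next
  case (Cons j js)
  have "\<exists>q\<in>lists S. length q \<le> length js * N \<and> (\<forall>i\<in>I. late D (T i) q (count_list js i))"
    using Cons.prems(2,3) by (intro Cons.IH Cons.prems(1)) auto
  then obtain q where q: "q \<in> lists S" "length q \<le> length js * N"
      "\<And>i. i \<in> I \<Longrightarrow> late D (T i) q (count_list js i)"
    by blast
  have len: "length q + N \<le> M" using q(2) Cons.prems(2) by simp
  have sub: "spanning_tree (subtower q (T i)) (tower (D - length q))" if "i \<in> I" for i
    using T that q(1) len \<open>M \<le> D\<close> by (intro spanning_tree_subtower) auto
  have "\<exists>p\<in>lists S. length p \<le> N \<and> late (D - length q) (subtower q (T j)) p 1"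
    using sub Cons.prems(1)[OF q(1) len] len \<open>M \<le> D\<close> Cons.prems(3)
    by (intro late_if_not_FC_levels) auto
  then obtain p where p: "p \<in> lists S" "length p \<le> N" "late (D - length q) (subtower q (T j)) p 1"
    by blast
  \<comment> \<open>The new piece is chosen for \<open>j\<close>; all other trees keep at least the
    excess they have.\<close>
  have "late D (T i) (q @ p) (count_list js i + (if i = j then 1 else 0))" if i: "i \<in> I" for i
  proof (rule late_append)
    show "late (D - length q) (subtower q (T i)) p (if i = j then 1 else 0)"
      using p late_0[OF sub[OF i] p(1)] len \<open>M \<le> D\<close> by auto
  qed (use T i q p len \<open>M \<le> D\<close> in auto)
  moreover have "count_list (j # js) i = count_list js i + (if i = j then 1 else 0)" for i
    by simp
  ultimately show ?case using q p by (intro bexI[of _ "q @ p"]) auto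
qed

lemma accumulate_late_set:
  assumes "\<And>i. i \<in> I \<Longrightarrow> spanning_tree (T i) (tower D)"
    and "\<And>p i. p \<in> lists S \<Longrightarrow> length p + N \<le> M \<Longrightarrow> i \<in> B \<Longrightarrow> \<not> FC_levels N (subtower p (T i))"
    and "M \<le> D" "card B * k * N \<le> M" "B \<subseteq> I" "finite B"
  shows "\<exists>q\<in>lists S. length q \<le> M \<and> (\<forall>i\<in>B. late D (T i) q k)"
proof -
  \<comment> \<open>A schedule that serves every tree of \<open>B\<close> at least \<open>k\<close>
    times, in \<open>card B * k\<close> rounds.\<close>
  have "\<exists>js. set js \<subseteq> B \<and> length js = card B * k \<and> (\<forall>i\<in>B. k \<le> count_list js i)"
    using assms(6)
  proof (induction B)
    case (insert x B)
    then obtain js where "set js \<subseteq> B" "length js = card B * k" "\<forall>i\<in>B. k \<le> count_list js i"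
      by blast
    moreover have "count_list (replicate k x) x = k" by (induction k) auto
    ultimately show ?case using insert.hyps
      by (intro exI[of _ "replicate k x @ js"]) (auto simp: trans_le_add2)
  qed simp
  then obtain js where js: "set js \<subseteq> B" "length js = card B * k" "\<And>i. i \<in> B \<Longrightarrow> k \<le> count_list js i"
    by blast
  have "\<exists>q\<in>lists S. length q \<le> length js * N \<and> (\<forall>i\<in>I. late D (T i) q (count_list js i))"
  proof (rule accumulate_late[where M = M])
    show "\<not> FC_levels N (subtower p (T i))" if "p \<in> lists S" "length p + N \<le> M" "i \<in> set js" for p i
      using assms(2) that js(1) by blast
  qed (use assms js in auto)
  then obtain q where q: "q \<in> lists S" "length q \<le> card B * k * N"
    "\<And>i. i \<in> I \<Longrightarrow> late D (T i) q (count_list js i)"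
    using js(2) by auto
  have "late D (T i) q k" if "i \<in> B" for i
    using q(3)[of i] js(3)[OF that] assms(5) that unfolding late_def by fastforce
  with q(1,2) assms(4) show ?thesis by (intro bexI[of _ q]) auto
qed


section \<open>Pairs far apart in all trees\<close>

text \<open>The trees form a family over an index set because distinct trees may have equal
  restrictions to a branch; the indices survive the passage to a smaller tower.\<close>

definition stretched_pair ::
  "real \<Rightarrow> nat \<Rightarrow> 'i set \<Rightarrow> ('i \<Rightarrow> ('a list \<times> 'a) ugraph) \<Rightarrow> bool" where
  "stretched_pair c D I T \<longleftrightarrow> (\<exists>u\<in>verts (tower D). \<exists>v\<in>verts (tower D).
     \<forall>i\<in>I. real (gdist (T i) u v) > real (gdist (tower D) u v) + c)"

text \<open>Branches keep their distances both in the trees and in the tower, so a pair found below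
  \<open>t\<close> serves above.\<close>

lemma stretched_pair_branch:
  assumes T: "\<And>i. i \<in> I \<Longrightarrow> spanning_tree (T i) (tower (Suc D))"
    and t: "t \<in> S" and "stretched_pair c D I (\<lambda>i. branch t (T i))"
  shows "stretched_pair c (Suc D) I T"
proof -
  obtain u v where uv: "u \<in> verts (tower D)" "v \<in> verts (tower D)"
      "\<And>i. i \<in> I \<Longrightarrow> real (gdist (branch t (T i)) u v) > real (gdist (tower D) u v) + c"
    using assms(3) unfolding stretched_pair_def by blast
  have "real (gdist (T i) (attach r t u) (attach r t v)) >
      real (gdist (tower (Suc D)) (attach r t u) (attach r t v)) + c" if "i \<in> I" for i
    using gdist_branch[of "T i" D t u v] gdist_branch[of "tower (Suc D)" D t u v] uv t
      tower_spanning_subgraph[OF T[OF that]] spanning_tree_imp_spanning_subgraph[OF T[OF that]] that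
    by (simp add: branch_tower del: gadget_graph.simps)
  then show ?thesis
    using uv(1,2) t unfolding stretched_pair_def by (metis attach_in_tower)
qed

lemma stretched_pair_subtower:
  "(\<And>i. i \<in> I \<Longrightarrow> spanning_tree (T i) (tower D)) \<Longrightarrow> p \<in> lists S \<Longrightarrow> length p \<le> D \<Longrightarrow>
    stretched_pair c (D - length p) I (\<lambda>i. subtower p (T i)) \<Longrightarrow> stretched_pair c D I T"
proof (induction p arbitrary: D T)
  case (Cons t p)
  then obtain D' where D: "D = Suc D'" by (cases D) auto
  have "stretched_pair c D' I (\<lambda>i. branch t (T i))"
  proof (rule Cons.IH)
    show "spanning_tree (branch t (T i)) (tower D')" if "i \<in> I" for i
      using Cons.prems(1,2) D that by (intro spanning_tree_branch) auto
  qed (use Cons.prems D in auto)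
  then show ?case
    using Cons.prems(1,2) unfolding D by (intro stretched_pair_branch[of I T D' t]) auto
qed simp

text \<open>The pair is the terminal \<open>t\<close> and the end of the descent \<open>q\<close>
  below \<open>t'\<close>. Trees outside \<open>B\<close> gain more than \<open>c\<close> between
  \<open>t\<close> and \<open>t'\<close>, those in \<open>B\<close> gain \<open>k\<close> below
  \<open>t'\<close>, and no tree makes up for this on the other part.\<close>

lemma stretched_pair_at_base:
  assumes T: "\<And>i. i \<in> I \<Longrightarrow> spanning_tree (T i) (tower (Suc D))"
    and t: "t \<in> S" "t' \<in> S"
    and far: "\<And>i. i \<in> I - B \<Longrightarrow> real (gdist (base (T i)) t t') > real (gdist G t t') + c"
    and q: "q \<in> lists S" "length q \<le> D" "\<And>i. i \<in> B \<Longrightarrow> late D (branch t' (T i)) q k"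
    and k: "real k > c"
  shows "stretched_pair c (Suc D) I T"
proof -
  have "real (gdist (T i) ([], t) (attach r t' (node q))) >
      real (gdist (tower (Suc D)) ([], t) (attach r t' (node q))) + c" if i: "i \<in> I" for i
  proof -
    have node: "node q \<in> verts (tower D)" using node_in_tower q by blast
    have "gdist (T i) ([], t) (attach r t' (node q)) =
        gdist (base (T i)) t t' + gdist (branch t' (T i)) ([], r) (node q)"
      using T i t S_sub node
      by (intro gdist_base_branch spanning_tree_imp_spanning_subgraph) auto
    moreover have "gdist (tower (Suc D)) ([], t) (attach r t' (node q)) =
        gdist G t t' + gdist (tower D) ([], r) (node q)"
      using gdist_base_branch[OF tower_spanning_subgraph[OF T[OF i]] t(2) S_sub[OF t(1)] node]
      by (simp only: base_tower branch_tower[OF t(2)])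
    moreover have "gdist G t t' \<le> gdist (base (T i)) t t'"
      using T i t S_sub spanning_tree_base
      by (intro gdist_spanning_subgraph_ge G_simple spanning_tree_imp_spanning_subgraph) auto
    moreover have "late D (branch t' (T i)) q 0"
      using T i t q by (intro late_0 spanning_tree_branch) auto
    moreover have "i \<in> B \<and> late D (branch t' (T i)) q k \<or>
        real (gdist (base (T i)) t t') > real (gdist G t t') + c"
      using far q(3) i by blast
    ultimately show ?thesis using k unfolding late_def by linarith
  qed
  then show ?thesis
    using t q node_in_tower S_sub unfolding stretched_pair_def
    by (metis attach_in_tower base_in_tower)
qed

text \<open>\<open>B\<close> contains the trees that may fail to be FC on the top \<open>N\<close> levels. If one of them is FC on
  sufficiently many levels of a smaller tower, it is dropped from \<open>B\<close> there; otherwise each of them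
  picks up excess in every such tower.\<close>

lemma exists_stretched_pair:
  assumes d: "d_gadget c d G r S"
  shows "\<exists>N\<ge>1. \<forall>D (I :: 'i set) T B. N \<le> D \<longrightarrow> finite I \<longrightarrow> enat (card I) \<le> d \<longrightarrow>
    (\<forall>i\<in>I. spanning_tree (T i) (tower D)) \<longrightarrow> B \<subseteq> I \<longrightarrow> card B \<le> n \<longrightarrow>
    (\<forall>i\<in>I - B. FC_levels N (T i)) \<longrightarrow> stretched_pair c D I T"
proof -
  \<comment> \<open>An excess that alone exceeds the tolerance.\<close>
  obtain k :: nat where k: "real k > c" using reals_Archimedean2 by blast
  have far: "\<exists>t\<in>S. \<exists>t'\<in>S. \<forall>i\<in>I - B. real (gdist (base (T i)) t t') > real (gdist G t t') + c"
    if "finite I" "enat (card I) \<le> d" "\<And>i. i \<in> I - B \<Longrightarrow> FC_tree G r S (base (T i))"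
    for I B :: "'i set" and T
  proof -
    \<comment> \<open>Indices may share a tree on the root copy, so this set can be smaller than
      \<open>I - B\<close>; the gadget property allows any number of trees up to
      \<open>d\<close>.\<close>
    let ?X = "(\<lambda>i. base (T i)) ` (I - B)"
    have "card ?X \<le> card I"
      by (meson Diff_subset card_image_le card_mono finite_Diff le_trans that(1))
    then have "at_most d ?X"
      using that(1,2) by (auto simp: at_most_def)
    moreover have "\<forall>T\<in>?X. FC_tree G r S T" using that(3) by blast
    ultimately have "\<exists>t\<in>S. \<exists>t'\<in>S. \<forall>T\<in>?X. real (gdist T t t') > real (gdist G t t') + c"
      using d unfolding d_gadget_def by (elim conjE allE[of _ ?X]) simp
    then show ?thesis by simp
  qed
  show ?thesis
  proof (induction n)
    case 0
    show ?case
    \<comment> \<open>With \<open>B\<close> empty, one level suffices: all trees are FC on the top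
      copy, and the empty descent is taken below \<open>t'\<close>.\<close>
    proof (intro exI[of _ "1::nat"] conjI allI impI)
      fix D and I :: "'i set" and T B
      assume *: "1 \<le> D" "finite I" "enat (card I) \<le> d" "\<forall>i\<in>I. spanning_tree (T i) (tower D)"
        "B \<subseteq> I" "card B \<le> 0" "\<forall>i\<in>I - B. FC_levels 1 (T i)"
      then have "B = {}" using finite_subset by fastforce
      obtain D' where D: "D = Suc D'" using *(1) by (cases D) auto
      obtain t t' where t: "t \<in> S" "t' \<in> S"
        "\<forall>i\<in>I - B. real (gdist (base (T i)) t t') > real (gdist G t t') + c"
        using far[of I B T] * by auto
      show "stretched_pair c D I T"
        unfolding D using * t k \<open>B = {}\<close>
        by (intro stretched_pair_at_base[where t = t and t' = t' and q = "[]" and B = B and k = k])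
          (auto simp: D simp del: gadget_graph.simps)
    qed simp
  next
    case (Suc n)
    then obtain N where "N \<ge> 1"
      and IH: "\<And>D (I :: 'i set) T B. N \<le> D \<Longrightarrow> finite I \<Longrightarrow> enat (card I) \<le> d \<Longrightarrow>
        (\<And>i. i \<in> I \<Longrightarrow> spanning_tree (T i) (tower D)) \<Longrightarrow> B \<subseteq> I \<Longrightarrow> card B \<le> n \<Longrightarrow>
        (\<And>i. i \<in> I - B \<Longrightarrow> FC_levels N (T i)) \<Longrightarrow> stretched_pair c D I T"
      by metis
    \<comment> \<open>At most \<open>Suc n\<close> trees need excess \<open>k\<close>, and each unit
      costs at most \<open>N\<close> levels. The depth bound below adds the top copy, on which
      \<open>t\<close> and \<open>t'\<close> are chosen, to \<open>M + N\<close> levels for the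
      descent.\<close>
    define M where "M = Suc n * k * N"
    show ?case
    proof (intro exI[of _ "Suc (M + N)"] conjI allI impI)
      fix D and I :: "'i set" and T B
      assume "Suc (M + N) \<le> D" and I: "finite I" "enat (card I) \<le> d"
        and T: "\<forall>i\<in>I. spanning_tree (T i) (tower D)"
        and B: "B \<subseteq> I" "card B \<le> Suc n" and FC: "\<forall>i\<in>I - B. FC_levels (Suc (M + N)) (T i)"
      then obtain D' where D: "D = Suc D'" "M + N \<le> D'" by (cases D) auto
      show "stretched_pair c D I T"
      proof (cases "\<exists>p\<in>lists S. length p + N \<le> Suc (M + N) \<and> (\<exists>i\<in>B. FC_levels N (subtower p (T i)))")
        case True
        then obtain p j where p: "p \<in> lists S" "length p + N \<le> Suc (M + N)"
          and j: "j \<in> B" "FC_levels N (subtower p (T j))" by blast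
        have "stretched_pair c (D - length p) I (\<lambda>i. subtower p (T i))"
        proof (rule IH[of "D - length p" I "\<lambda>i. subtower p (T i)" "B - {j}"])
          show "card (B - {j}) \<le> n"
            using B j(1) I(1) by (auto simp: card_Diff_singleton dest: finite_subset)
          \<comment> \<open>The tree \<open>j\<close> qualifies by its choice; the trees outside
            \<open>B\<close> were FC on so many levels that \<open>N\<close> remain below
            \<open>p\<close>.\<close>
          show "FC_levels N (subtower p (T i))" if "i \<in> I - (B - {j})" for i
            using that j p FC FC_levels_subtower by blast
          show "spanning_tree (subtower p (T i)) (tower (D - length p))" if "i \<in> I" for i
            using that T p D by (intro spanning_tree_subtower) auto
        qed (use I B p D in auto)
        then show ?thesis
          using T p D by (intro stretched_pair_subtower[of I T D p]) auto
      next
        case False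
        have "FC_tree G r S (base (T i))" if "i \<in> I - B" for i
          using FC that by auto
        then obtain t t' where t: "t \<in> S" "t' \<in> S"
          "\<forall>i\<in>I - B. real (gdist (base (T i)) t t') > real (gdist G t t') + c"
          using far[OF I] by blast
        have "\<exists>q\<in>lists S. length q \<le> M + N \<and> (\<forall>i\<in>B. late D' (branch t' (T i)) q k)"
        proof (rule accumulate_late_set[where I = I and N = N])
          show "spanning_tree (branch t' (T i)) (tower D')" if "i \<in> I" for i
            using that T t D by (intro spanning_tree_branch) auto
          show "\<not> FC_levels N (subtower p (branch t' (T i)))"
            if "p \<in> lists S" "length p + N \<le> M + N" "i \<in> B" for p i
            \<comment> \<open>An address \<open>p\<close> below \<open>t'\<close> is
              \<open>t' # p\<close> in the whole tower; the extra entry is absorbed by the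
              \<open>Suc\<close> in the case distinction.\<close>
            using False that t(2) by (auto dest!: bspec[of _ _ "t' # p"])
          have "card B * k * N \<le> M"
            unfolding M_def using B(2) by (intro mult_le_mono1)
          then show "card B * k * N \<le> M + N" by simp
        qed (use B I D finite_subset in auto)
        then obtain q where "q \<in> lists S" "length q \<le> D'" "\<And>i. i \<in> B \<Longrightarrow> late D' (branch t' (T i)) q k"
          using D(2) by (meson le_trans)
        then show ?thesis
          unfolding D(1) using T t k
          by (intro stretched_pair_at_base[where t = t and t' = t' and q = q and B = B and k = k])
          (auto simp: D simp del: gadget_graph.simps)
      qed
    qed simp
  qed
qed

section \<open>Failure of collective spanning\<close>

lemma no_collective_spanning:
  assumes d: "d_gadget c d G r S" and m: "enat m \<le> d"
  shows "\<exists>D0\<ge>1. \<forall>D\<ge>D0. \<not> (\<exists>\<T>. at_most (enat m) \<T> \<and> collectively_spans c \<T> (tower D))"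
proof -
  obtain N where "N \<ge> 1"
    and N: "\<And>D \<T>. N \<le> D \<Longrightarrow> finite \<T> \<Longrightarrow> enat (card \<T>) \<le> d \<Longrightarrow>
      \<forall>T\<in>\<T>. spanning_tree T (tower D) \<Longrightarrow> card \<T> \<le> m \<Longrightarrow> stretched_pair c D \<T> (\<lambda>T. T)"
    \<comment> \<open>The set of trees indexes itself, and \<open>B\<close> is the whole of it:
      nothing is known about any tree at the start, and the condition on \<open>I - B\<close> is
      vacuous.\<close>
    using exists_stretched_pair[OF d, of m] by (metis Diff_cancel empty_iff order_refl)
  have "\<not> collectively_spans c \<T> (tower D)" if "N \<le> D" "at_most (enat m) \<T>" for D \<T>
  proof
    assume span: "collectively_spans c \<T> (tower D)"
    have \<T>: "finite \<T>" "card \<T> \<le> m" using that(2) by (auto simp: at_most_def)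
    then have "enat (card \<T>) \<le> d" using m by (meson enat_ord_simps(1) order_trans)
    then have "stretched_pair c D \<T> (\<lambda>T. T)"
      using N that(1) \<T> span by (simp add: collectively_spans_def)
    then show False
      using span unfolding stretched_pair_def collectively_spans_def
      by (meson linorder_not_less)
  qed
  with \<open>N \<ge> 1\<close> show ?thesis by blast
qed

end

theorem theorem5:
  fixes c :: real and d :: enat and G :: "'a ugraph" and r :: 'a and S :: "'a set"
  assumes "c \<ge> 2" and "d \<ge> 2" and "d_gadget c d G r S"
  shows "(\<forall>k. d = enat k \<longrightarrow>
            (\<exists>D0\<ge>1. \<forall>D\<ge>D0.
               \<not> (\<exists>\<T>. at_most (enat k) \<T> \<and> collectively_spans c \<T> (gadget_graph G r S D)))) \<and>
         (d = \<infinity> \<longrightarrow>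
            (\<forall>m::nat. m \<ge> 1 \<longrightarrow>
               (\<exists>D0\<ge>1. \<forall>D\<ge>D0.
                  \<not> (\<exists>\<T>. at_most (enat m) \<T> \<and> collectively_spans c \<T> (gadget_graph G r S D)))))"
proof -
  interpret gadget_tower G r S
    using assms(3) by unfold_locales (simp add: d_gadget_def)
  show ?thesis using no_collective_spanning[OF assms(3)] by simp
qed

end
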